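(* Let $d\ge 1$, let $\mathcal D$ be a collection of bounded domains in $\mathbb C^d$, and let an abstract boundary $\partial_\ast$ suitable for $\mathcal D$ be given. Let $D,D'\in\mathcal D$ be model domains for this abstract boundary. Then every biholomorphism $F:D\to D'$ extends to a homeomorphism from $\overline{D}$ to $\overline{D'}$ (Euclidean closures). The extension of $F$ is given by $\mathsf{id}_{D'}^\ast\circ F^\ast\circ(\mathsf{id}_{D}^\ast)^{-1}$.
   Context: For a bounded domain (connected open set) $D\subset\mathbb C^d$, $\overline D$ denotes its closure in $\mathbb C^d$ with the Euclidean topology. An abstract boundary $\partial_\ast D$ for $D$ is a topological space such that the disjoint union $\overline{D}^\ast:=D\sqcup\partial_\ast D$ is equipped with a topology whose restriction to $D$ is the Euclidean topology and whose restriction to $\partial_\ast D$ is the topology of $\partial_\ast D$. Let $\mathcal D$ be a collection of bounded domains in $\mathbb C^d$, and let an abstract boundary $\partial_\ast D$ (with the topological space $\overline{D}^\ast$) be assigned to each $D\in\mathcal D$. This abstract boundary is suitable for $\mathcal D$ if for every biholomorphism $F:D\to D'$ with $D,D'\in\mathcal D$ there exists a homeomorphism $F^\ast:\overline{D}^\ast\to\overline{D'}^\ast$ such that $F^\ast|_D=F$. A domain $D\in\mathcal D$ is a model domain for an abstract boundary suitable for $\mathcal D$ if the identity map $\mathsf{id}:D\to D$ extends to a homeomorphism $\mathsf{id}_D^\ast:\overline{D}^\ast\to\overline{D}$. *)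

theory Defs
  imports "HOL-Analysis.Analysis"
begin

text \<open>Points of complex \<open>d\<close>-space are vectors \<open>complex ^ 'd\<close> with \<open>d = CARD('d) \<ge> 1\<close>.\<close>

definition bounded_domain :: "(complex ^ 'd) set \<Rightarrow> bool" where
  "bounded_domain D \<longleftrightarrow> open D \<and> connected D \<and> bounded D"

text \<open>Holomorphy in several variables: at every point there is a Frechet derivative that is linear
  over the complex numbers (\<open>has_derivative\<close> by itself only gives real linearity).\<close>

definition holomorphic_map :: "(complex ^ 'm) set \<Rightarrow> (complex ^ 'm \<Rightarrow> complex ^ 'n) \<Rightarrow> bool" where
  "holomorphic_map D F \<longleftrightarrow>
     (\<forall>z\<in>D. \<exists>F'. (F has_derivative F') (at z) \<and> Vector_Spaces.linear (*s) (*s) F')"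

definition biholomorphism ::
    "(complex ^ 'd) set \<Rightarrow> (complex ^ 'd) set \<Rightarrow> (complex ^ 'd \<Rightarrow> complex ^ 'd) \<Rightarrow> bool" where
  "biholomorphism D D' F \<longleftrightarrow>
     bij_betw F D D' \<and> holomorphic_map D F \<and> holomorphic_map D' (inv_into D F)"

text \<open>\<open>B\<close> is the boundary space and \<open>T\<close> the topology on the disjoint union of \<open>D\<close> and the boundary.
  The disjoint union is formed in a sum type, so that ``the restriction of \<open>T\<close> to a summand is the
  given topology'' says that the injection of that summand is an embedding. Neither summand is
  required to be open or closed in \<open>T\<close>.\<close>

definition abstract_boundary ::
    "(complex ^ 'd) set \<Rightarrow> 'b topology \<Rightarrow> (complex ^ 'd + 'b) topology \<Rightarrow> bool" where
  "abstract_boundary D B T \<longleftrightarrow>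
     topspace T = D <+> topspace B \<and>
     embedding_map (top_of_set D) T Inl \<and>
     embedding_map B T Inr"

definition star_extension ::
    "((complex ^ 'd) set \<Rightarrow> (complex ^ 'd + 'b) topology) \<Rightarrow>
     (complex ^ 'd) set \<Rightarrow> (complex ^ 'd) set \<Rightarrow> (complex ^ 'd \<Rightarrow> complex ^ 'd) \<Rightarrow>
     (complex ^ 'd + 'b \<Rightarrow> complex ^ 'd + 'b) \<Rightarrow> bool" where
  "star_extension T D D' F Fs \<longleftrightarrow>
     homeomorphic_map (T D) (T D') Fs \<and> (\<forall>z\<in>D. Fs (Inl z) = Inl (F z))"

text \<open>The assignments \<open>B\<close> and \<open>T\<close> only matter on members of \<open>\<D>\<close>. Using one type \<open>'b\<close> for
  the boundary points of all domains is no restriction, since the carrier of \<open>B D\<close> may be any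
  subset of it.\<close>

definition suitable_boundary ::
    "(complex ^ 'd) set set \<Rightarrow> ((complex ^ 'd) set \<Rightarrow> 'b topology) \<Rightarrow>
     ((complex ^ 'd) set \<Rightarrow> (complex ^ 'd + 'b) topology) \<Rightarrow> bool" where
  "suitable_boundary \<D> B T \<longleftrightarrow>
     (\<forall>D\<in>\<D>. abstract_boundary D (B D) (T D)) \<and>
     (\<forall>D\<in>\<D>. \<forall>D'\<in>\<D>. \<forall>F. biholomorphism D D' F \<longrightarrow> (\<exists>Fs. star_extension T D D' F Fs))"

definition id_extension ::
    "((complex ^ 'd) set \<Rightarrow> (complex ^ 'd + 'b) topology) \<Rightarrow> (complex ^ 'd) set \<Rightarrow>
     (complex ^ 'd + 'b \<Rightarrow> complex ^ 'd) \<Rightarrow> bool" where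
  "id_extension T D j \<longleftrightarrow>
     homeomorphic_map (T D) (top_of_set (closure D)) j \<and> (\<forall>z\<in>D. j (Inl z) = z)"

definition model_domain ::
    "(complex ^ 'd) set set \<Rightarrow> ((complex ^ 'd) set \<Rightarrow> (complex ^ 'd + 'b) topology) \<Rightarrow>
     (complex ^ 'd) set \<Rightarrow> bool" where
  "model_domain \<D> T D \<longleftrightarrow> D \<in> \<D> \<and> (\<exists>j. id_extension T D j)"

definition closure_extension ::
    "(complex ^ 'd) set \<Rightarrow> (complex ^ 'd) set \<Rightarrow> (complex ^ 'd \<Rightarrow> complex ^ 'd) \<Rightarrow>
     (complex ^ 'd \<Rightarrow> complex ^ 'd) \<Rightarrow> bool" where
  "closure_extension D D' F G \<longleftrightarrow>
     homeomorphic_map (top_of_set (closure D)) (top_of_set (closure D')) G \<and>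
     (\<forall>z\<in>D. G z = F z)"

end

theory Submission imports Defs begin

text \<open>The three maps compose along the chain
  \<open>closure D \<rightarrow> T D \<rightarrow> T D' \<rightarrow> closure D'\<close>, so the composite is a homeomorphism. It restricts to
  \<open>F\<close> because every map of the chain prolongs the corresponding map of the domains: a point \<open>z\<close> of
  \<open>D\<close> goes to \<open>Inl z\<close>, then to \<open>Inl (F z)\<close>, then to \<open>F z\<close>. Any other extension agrees with it on
  the dense subset \<open>D\<close>, hence on \<open>closure D\<close>, since the target is Hausdorff.\<close>

text \<open>\<open>homeomorphic_map_maps\<close> only asserts that some inverse homeomorphism exists; here it is
  identified with the inverse chosen by \<open>inv_into\<close>, which agrees with it on the topological space
  but may differ outside.\<close>

lemma homeomorphic_map_inv_into:
  assumes "homeomorphic_map X Y f"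
  shows "homeomorphic_map Y X (inv_into (topspace X) f)"
proof -
  obtain g where g: "homeomorphic_maps X Y f g"
    using assms homeomorphic_map_maps by blast
  have inj: "inj_on f (topspace X)"
    using assms by (simp add: homeomorphic_eq_everything_map)
  have "homeomorphic_map Y X g"
    using g homeomorphic_maps_map by blast
  moreover have "g y = inv_into (topspace X) f y" if "y \<in> topspace Y" for y
  proof -
    have "g y \<in> topspace X" "f (g y) = y"
      using g that by (auto simp: homeomorphic_maps_def continuous_map_def)
    then show ?thesis
      using inj by (metis inv_into_f_f)
  qed
  ultimately show ?thesis
    by (rule homeomorphic_map_eq)
qed

lemma closure_extension_via_boundary:
  assumes "abstract_boundary D B (T D)"
    and "F ` D \<subseteq> D'"
    and j: "id_extension T D j"
    and j': "id_extension T D' j'"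
    and Fs: "star_extension T D D' F Fs"
  shows "closure_extension D D' F (j' \<circ> Fs \<circ> inv_into (topspace (T D)) j)"
proof -
  have j_homeo: "homeomorphic_map (T D) (top_of_set (closure D)) j"
    using j by (simp add: id_extension_def)
  have "homeomorphic_map (top_of_set (closure D)) (top_of_set (closure D'))
          (j' \<circ> Fs \<circ> inv_into (topspace (T D)) j)"
    using homeomorphic_map_inv_into [OF j_homeo] j' Fs
    unfolding id_extension_def star_extension_def
    by (metis homeomorphic_map_compose)
  moreover have "(j' \<circ> Fs \<circ> inv_into (topspace (T D)) j) z = F z" if "z \<in> D" for z
  proof -
    have "Inl z \<in> topspace (T D)" "j (Inl z) = z"
      using assms(1) j that by (auto simp: abstract_boundary_def id_extension_def)
    moreover have "inj_on j (topspace (T D))"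
      using j_homeo by (simp add: homeomorphic_eq_everything_map)
    ultimately have "inv_into (topspace (T D)) j z = Inl z"
      by (metis inv_into_f_f)
    moreover have "F z \<in> D'"
      using assms(2) that by blast
    ultimately show ?thesis
      using j' Fs that by (simp add: id_extension_def star_extension_def)
  qed
  ultimately show ?thesis
    by (simp add: closure_extension_def)
qed

lemma closure_extension_unique:
  assumes G: "closure_extension D D' F G"
    and H: "closure_extension D D' F H"
    and z: "z \<in> closure D"
  shows "G z = H z"
proof (rule forall_in_closure_of_eq [where f = G and g = H])
  show "z \<in> top_of_set (closure D) closure_of D"
    using z by (simp add: closure_of_subtopology
        closure_subset inf.absorb2)
  show "Hausdorff_space (top_of_set (closure D'))"
    by (simp add: Hausdorff_space_subtopology)
  show "continuous_map (top_of_set (closure D)) (top_of_set (closure D')) G"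
    "continuous_map (top_of_set (closure D)) (top_of_set (closure D')) H"
    using G H unfolding closure_extension_def by (blast intro: homeomorphic_imp_continuous_map)+
  show "G x = H x" if "x \<in> D" for x
    using G H that by (simp add: closure_extension_def)
qed

theorem theorem2p5:
  fixes \<D> :: "(complex ^ 'd) set set"
    and B :: "(complex ^ 'd) set \<Rightarrow> 'b topology"
    and T :: "(complex ^ 'd) set \<Rightarrow> (complex ^ 'd + 'b) topology"
    and D D' :: "(complex ^ 'd) set"
    and F :: "complex ^ 'd \<Rightarrow> complex ^ 'd"
  assumes "\<forall>E\<in>\<D>. bounded_domain E"
    and "suitable_boundary \<D> B T"
    and "model_domain \<D> T D"
    and "model_domain \<D> T D'"
    and "biholomorphism D D' F"
  shows "(\<exists>G. closure_extension D D' F G) \<and>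
    (\<forall>j j' Fs. id_extension T D j \<longrightarrow> id_extension T D' j' \<longrightarrow> star_extension T D D' F Fs \<longrightarrow>
       closure_extension D D' F (j' \<circ> Fs \<circ> inv_into (topspace (T D)) j) \<and>
       (\<forall>G. closure_extension D D' F G \<longrightarrow>
          (\<forall>z\<in>closure D. G z = (j' \<circ> Fs \<circ> inv_into (topspace (T D)) j) z)))"
proof -
  have "D \<in> \<D>" "D' \<in> \<D>"
    using assms(3,4) by (auto simp: model_domain_def)
  then have boundary: "abstract_boundary D (B D) (T D)"
    and "\<exists>Fs. star_extension T D D' F Fs"
    using assms(2,5) by (auto simp: suitable_boundary_def)
  then obtain Fs j j' where "star_extension T D D' F Fs"
    and "id_extension T D j" "id_extension T D' j'"
    using assms(3,4) by (auto simp: model_domain_def)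
  moreover have "F ` D \<subseteq> D'"
    using assms(5) by (auto simp: biholomorphism_def bij_betw_def)
  ultimately show ?thesis
    using closure_extension_via_boundary [where B = "B D"] closure_extension_unique boundary
    by meson
qed

end
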